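(* Let $G$ and $H$ be graphs with $\phi_H=\phi_G$ and $M_H=M_G$. Write $\phi_G(x)=\prod_{i=1}^{r} f_i(x)^{m_i}$, where $f_1,\ldots,f_r$ are distinct monic polynomials irreducible over $\mathbb Q$ and $m_i\ge 1$, and let $I_{\mathrm m}(G)\subseteq\{1,\ldots,r\}$ be the set of indices $i$ with $f_i\mid M_G$. Let $H=H_1\cup\cdots\cup H_{c(H)}$ be the decomposition of $H$ into connected components, and set $a_{ji}:=\operatorname{ord}_{f_i}(\phi_{H_j})$ for $1\le j\le c(H)$, $1\le i\le r$. Then $$\sum_{j=1}^{c(H)} a_{ji}=m_i\qquad (1\le i\le r),$$ and every component contains at least one main irreducible factor: $$\sum_{i\in I_{\mathrm m}(G)} a_{ji}\ge 1\qquad (1\le j\le c(H)).$$ Consequently, $c(H)\le \kappa_{\mathrm m}(G)$.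
   Context: All graphs are finite, simple and undirected. For a graph $G$, $A(G)$ is its adjacency matrix, $\phi_G(x)=\det(xI-A(G))$ its characteristic polynomial, $\mathbf 1$ the all-one vector, and $c(G)$ the number of connected components. An adjacency eigenvalue $\lambda$ of $G$ is main if its eigenspace is not orthogonal to $\mathbf 1$. If $\lambda_1,\ldots,\lambda_s$ are the distinct main eigenvalues of $G$, the main polynomial is $M_G(x)=\prod_{i=1}^s (x-\lambda_i)$; it is a square-free divisor of $\phi_G$ in $\mathbb Z[x]$, so $M_G=\prod_{i\in I_{\mathrm m}(G)}f_i$ in the notation of the claim. The main-factor multiplicity is $\kappa_{\mathrm m}(G):=\sum_{i\in I_{\mathrm m}(G)} m_i$. For an irreducible polynomial $f$, $\operatorname{ord}_f(\phi)$ denotes the multiplicity of $f$ as a factor of $\phi$ over $\mathbb Q$. *)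

theory Defs
  imports "Graph_Theory.Graph_Theory" "Jordan_Normal_Form.Char_Poly"
    "HOL-Computational_Algebra.Field_as_Ring"
begin

text \<open>
  A finite simple undirected graph is an instance of the locale \<^locale>\<open>graph\<close> of
  \<open>Graph_Theory\<close>: an edge is represented by a pair of opposite arcs.
\<close>

definition components :: "('a,'b) pre_digraph \<Rightarrow> ('a,'b) pre_digraph set" where
  "components G = {C. pre_digraph.max_subgraph G connected C}"

definition num_components :: "('a,'b) pre_digraph \<Rightarrow> nat" where
  "num_components G = card (components G)"

text \<open>
  Matrices are indexed by natural numbers, so writing down the adjacency matrix needs an
  enumeration of the vertices. It is chosen arbitrarily; another choice conjugates the matrix
  by a permutation matrix, which affects neither the characteristic polynomial nor the main
  eigenvalues.
\<close>

definition vertex_enum :: "('a,'b) pre_digraph \<Rightarrow> nat \<Rightarrow> 'a" where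
  "vertex_enum G = (SOME e. bij_betw e {0..<card (verts G)} (verts G))"

definition adj_matrix :: "('a,'b) pre_digraph \<Rightarrow> 'c :: zero_neq_one mat" where
  "adj_matrix G = mat (card (verts G)) (card (verts G))
     (\<lambda>(i,j). if vertex_enum G i \<rightarrow>\<^bsub>G\<^esub> vertex_enum G j then 1 else 0)"

definition graph_char_poly :: "('a,'b) pre_digraph \<Rightarrow> rat poly" where
  "graph_char_poly G = char_poly (adj_matrix G)"

text \<open>
  The adjacency matrix is real symmetric, so all its eigenvalues, and hence all main ones,
  are real.
\<close>

definition main_eigenvalue :: "('a,'b) pre_digraph \<Rightarrow> real \<Rightarrow> bool" where
  "main_eigenvalue G \<theta> \<longleftrightarrow>
     (\<exists>v. eigenvector (adj_matrix G) v \<theta> \<and> v \<bullet> vec (card (verts G)) (\<lambda>_. 1) \<noteq> 0)"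

definition main_poly :: "('a,'b) pre_digraph \<Rightarrow> real poly" where
  "main_poly G = (\<Prod>\<theta> | main_eigenvalue G \<theta>. [:- \<theta>, 1:])"

text \<open>
  In the next two definitions \<open>f 1, \<dots>, f r\<close> are the distinct monic irreducible factors of the
  characteristic polynomial of \<open>G\<close> and \<open>m 1, \<dots>, m r\<close> their multiplicities.
  Since the main polynomial has rational coefficients, divisibility over the reals
  coincides with divisibility over the rationals.
\<close>

definition main_indices :: "('a,'b) pre_digraph \<Rightarrow> nat \<Rightarrow> (nat \<Rightarrow> rat poly) \<Rightarrow> nat set" where
  "main_indices G r f = {i \<in> {1..r}. map_poly of_rat (f i) dvd main_poly G}"

definition main_factor_multiplicity ::
  "('a,'b) pre_digraph \<Rightarrow> nat \<Rightarrow> (nat \<Rightarrow> rat poly) \<Rightarrow> (nat \<Rightarrow> nat) \<Rightarrow> nat" where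
  "main_factor_multiplicity G r f m = (\<Sum>i\<in>main_indices G r f. m i)"

end

theory Submission
  imports Defs
begin

text \<open>
  The characteristic polynomial of \<open>H\<close> is the product of those of its components, which gives the
  first claim by comparing multiplicities. For the second, let \<open>A\<close> be the adjacency matrix of a
  component. The cyclic subspace generated by the all-one vector under \<open>A\<close> contains an eigenvector
  of \<open>A\<close>, and by symmetry of \<open>A\<close> this eigenvector is not orthogonal to the all-one vector; so each
  component has a main eigenvalue \<open>\<theta>\<close>. Extending the eigenvector by zero shows that \<open>\<theta>\<close> is a main
  eigenvalue of \<open>H\<close>, hence of \<open>G\<close>. Let \<open>f\<close> be the irreducible factor with root \<open>\<theta>\<close>. It divides the
  characteristic polynomial of the component, and it divides the main polynomial of \<open>G\<close>, because the
  main polynomial is the minimal annihilating polynomial of the all-one vector, whether computed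
  over the rationals or over the reals. Summing the second claim over all components bounds their
  number.
\<close>

section \<open>Polynomials in a matrix acting on vectors\<close>

lemma coeff_sum_monom:
  "coeff (\<Sum>k<d. monom (c k) k) j = (if j < d then c j else 0)"
  for c :: "nat \<Rightarrow> 'a::comm_monoid_add"
  by (simp add: coeff_sum)

text \<open>Vectors are functions on the index set itself, so a graph needs no enumeration of its
  vertices here. The result is a function on the whole type, but it depends on \<open>x\<close> only
  through its values on \<open>V\<close>.\<close>

definition matop :: "'i set \<Rightarrow> ('i \<Rightarrow> 'i \<Rightarrow> 'a::comm_semiring_1) \<Rightarrow> ('i \<Rightarrow> 'a) \<Rightarrow> 'i \<Rightarrow> 'a" where
  "matop V a x = (\<lambda>i. \<Sum>j\<in>V. a i j * x j)"

text \<open>This is p(A)x. The term for \<open>k = 0\<close> is \<open>x\<close> itself, so off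
  \<open>V\<close> the value still depends on \<open>x\<close> there; identities about it are
  therefore mostly restricted to \<open>V\<close>.\<close>

definition polyop ::
  "'i set \<Rightarrow> ('i \<Rightarrow> 'i \<Rightarrow> 'a::comm_semiring_1) \<Rightarrow> 'a poly \<Rightarrow> ('i \<Rightarrow> 'a) \<Rightarrow> 'i \<Rightarrow> 'a" where
  "polyop V a p x = (\<lambda>i. \<Sum>k\<le>degree p. coeff p k * (matop V a ^^ k) x i)"

definition dotp :: "'i set \<Rightarrow> ('i \<Rightarrow> 'a::comm_semiring_1) \<Rightarrow> ('i \<Rightarrow> 'a) \<Rightarrow> 'a" where
  "dotp V x y = (\<Sum>i\<in>V. x i * y i)"

lemma matop_cong: "(\<And>i. i \<in> V \<Longrightarrow> x i = y i) \<Longrightarrow> matop V a x = matop V a y"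
  by (simp add: matop_def)

lemma matop_zero [simp]: "matop V a (\<lambda>_. 0) = (\<lambda>_. 0)"
  by (simp add: matop_def)

lemma matop_sum: "matop V a (\<lambda>i. \<Sum>k\<in>K. c k * y k i) = (\<lambda>i. \<Sum>k\<in>K. c k * matop V a (y k) i)"
  unfolding matop_def sum_distrib_left
  by (rule ext, subst sum.swap) (simp add: mult_ac)

text \<open>Any bound above the degree may replace the degree, so polynomials of different degrees
  can share one range of summation.\<close>

lemma polyop_altdef:
  assumes "degree p < d"
  shows "polyop V a p x i = (\<Sum>k<d. coeff p k * (matop V a ^^ k) x i)"
  unfolding polyop_def
  using assms by (intro sum.mono_neutral_left) (auto simp: coeff_eq_0)

lemma polyop_0 [simp]: "polyop V a 0 x = (\<lambda>_. 0)"
  by (simp add: polyop_def)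

lemma polyop_pCons [simp]:
  "polyop V a (pCons c p) x = (\<lambda>i. c * x i + matop V a (polyop V a p x) i)"
proof
  fix i
  let ?T = "matop V a"
  have "degree (pCons c p) < Suc (Suc (degree p))"
    by (simp add: degree_pCons_eq_if)
  from polyop_altdef[OF this]
  have "polyop V a (pCons c p) x i = (\<Sum>k<Suc (Suc (degree p)). coeff (pCons c p) k * (?T ^^ k) x i)" .
  also have "\<dots> = c * x i + (\<Sum>k<Suc (degree p). coeff p k * ?T ((?T ^^ k) x) i)"
    by (subst sum.lessThan_Suc_shift) simp
  also have "(\<Sum>k<Suc (degree p). coeff p k * ?T ((?T ^^ k) x) i) = ?T (polyop V a p x) i"
    unfolding polyop_def matop_sum by (simp add: lessThan_Suc_atMost)
  finally show "polyop V a (pCons c p) x i = c * x i + ?T (polyop V a p x) i" .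
qed

lemma polyop_add: "polyop V a (p + q) x = (\<lambda>i. polyop V a p x i + polyop V a q x i)"
proof
  fix i
  define d where "d = Suc (max (degree p) (degree q))"
  have "degree (p + q) < d" "degree p < d" "degree q < d"
    using degree_add_le_max[of p q] by (auto simp: d_def)
  then show "polyop V a (p + q) x i = polyop V a p x i + polyop V a q x i"
    by (simp add: polyop_altdef[of _ d] sum.distrib distrib_right)
qed

lemma polyop_smult: "polyop V a (Polynomial.smult c p) x = (\<lambda>i. c * polyop V a p x i)"
proof
  fix i
  have "degree (Polynomial.smult c p) < Suc (degree p)"
    using degree_smult_le[of c p] by simp
  then show "polyop V a (Polynomial.smult c p) x i = c * polyop V a p x i"
    by (simp add: polyop_altdef[of _ "Suc (degree p)"] sum_distrib_left mult.assoc del: sum.lessThan_Suc)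
qed

text \<open>Turns a factorization of an annihilating polynomial into successive actions on
  \<open>x\<close>.\<close>

lemma polyop_mult: "polyop V a (p * q) x = polyop V a p (polyop V a q x)"
  by (induct p) (simp_all add: polyop_add polyop_smult)

lemma polyop_cong:
  assumes "\<And>i. i \<in> V \<Longrightarrow> x i = y i" and "i \<in> V"
  shows "polyop V a p x i = polyop V a p y i"
  using assms(2)
proof (induct p arbitrary: i)
  case (pCons c p)
  then have "matop V a (polyop V a p x) = matop V a (polyop V a p y)"
    by (intro matop_cong) auto
  then show ?case using pCons assms(1) by simp
qed simp

lemma polyop_zero [simp]: "polyop V a p (\<lambda>_. 0) = (\<lambda>_. 0)"
  by (induct p) simp_all

lemma polyop_vanish:
  assumes "\<And>i. i \<in> V \<Longrightarrow> x i = 0" and "i \<in> V"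
  shows "polyop V a p x i = 0"
  using polyop_cong[of V x "\<lambda>_. 0" i a p] assms by simp

lemma polyop_eigenvector:
  assumes "\<And>i. i \<in> V \<Longrightarrow> matop V a x i = \<theta> * x i" and "i \<in> V"
  shows "polyop V a p x i = poly p \<theta> * x i"
  using assms(2)
proof (induct p arbitrary: i)
  case (pCons c p)
  then have "matop V a (polyop V a p x) = matop V a (\<lambda>j. poly p \<theta> * x j)"
    by (intro matop_cong) auto
  also have "\<dots> = (\<lambda>j. poly p \<theta> * matop V a x j)"
    by (simp add: matop_def sum_distrib_left mult_ac)
  finally show ?case using pCons assms(1) by (simp add: algebra_simps)
qed simp

section \<open>The inner product and self-adjointness of symmetric matrices\<close>

lemma dotp_commute: "dotp V x y = dotp V y x"
  by (simp add: dotp_def mult.commute)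

lemma dotp_cong:
  "(\<And>i. i \<in> V \<Longrightarrow> x i = x' i) \<Longrightarrow> (\<And>i. i \<in> V \<Longrightarrow> y i = y' i) \<Longrightarrow> dotp V x y = dotp V x' y'"
  by (simp add: dotp_def)

lemma dotp_zero: "(\<And>i. i \<in> V \<Longrightarrow> y i = 0) \<Longrightarrow> dotp V x y = 0"
  by (simp add: dotp_def)

lemma dotp_scale: "dotp V (\<lambda>i. c * x i) y = c * dotp V x y"
  by (simp add: dotp_def sum_distrib_left mult_ac)

lemma dotp_add: "dotp V (\<lambda>i. x i + y i) z = dotp V x z + dotp V y z"
  by (simp add: dotp_def sum.distrib algebra_simps)

lemma dotp_sum: "dotp V x (\<lambda>i. \<Sum>k\<in>K. c k * y k i) = (\<Sum>k\<in>K. c k * dotp V x (y k))"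
  unfolding dotp_def sum_distrib_left
  by (subst sum.swap) (simp add: mult_ac)

lemma dotp_self_eq_0:
  fixes x :: "'i \<Rightarrow> 'a::linordered_field"
  assumes "finite V" and "dotp V x x \<le> 0" and "i \<in> V"
  shows "x i = 0"
proof -
  have "dotp V x x = 0"
    using assms(2) by (auto simp: dotp_def intro!: antisym sum_nonneg)
  then show ?thesis
    using assms by (auto simp: dotp_def sum_nonneg_eq_0_iff)
qed

lemma matop_adjoint:
  assumes "\<And>i j. i \<in> V \<Longrightarrow> j \<in> V \<Longrightarrow> a i j = a j i"
  shows "dotp V (matop V a x) y = dotp V x (matop V a y)"
proof -
  have "dotp V (matop V a x) y = (\<Sum>i\<in>V. \<Sum>j\<in>V. a i j * x j * y i)"
    by (simp add: dotp_def matop_def sum_distrib_right)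
  also have "\<dots> = (\<Sum>j\<in>V. \<Sum>i\<in>V. a i j * x j * y i)"
    by (rule sum.swap)
  also have "\<dots> = (\<Sum>j\<in>V. \<Sum>i\<in>V. a j i * x j * y i)"
    using assms by (intro sum.cong refl) simp
  also have "\<dots> = dotp V x (matop V a y)"
    by (simp add: dotp_def matop_def sum_distrib_left mult_ac)
  finally show ?thesis .
qed

lemma polyop_adjoint:
  assumes "\<And>i j. i \<in> V \<Longrightarrow> j \<in> V \<Longrightarrow> a i j = a j i"
  shows "dotp V (polyop V a p x) y = dotp V x (polyop V a p y)"
proof (induct p arbitrary: x y)
  case 0
  show ?case by (simp add: dotp_def)
next
  case (pCons c p)
  have comm: "matop V a (polyop V a p y) = polyop V a p (matop V a y)"
  proof -
    \<comment> \<open>The matrix is its own polynomial X, so it commutes with p(A) because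
      polynomials commute.\<close>
    have "polyop V a (p * [:0, 1:]) y = polyop V a ([:0, 1:] * p) y"
      by (simp only: mult.commute)
    then show ?thesis
      unfolding polyop_mult by simp
  qed
  have "dotp V (matop V a (polyop V a p x)) y = dotp V x (polyop V a p (matop V a y))"
    using pCons matop_adjoint[of V a "polyop V a p x" y] assms by simp
  then have "dotp V (polyop V a (pCons c p) x) y = c * dotp V x y + dotp V x (matop V a (polyop V a p y))"
    by (simp add: dotp_add dotp_scale comm)
  also have "\<dots> = dotp V x (polyop V a (pCons c p) y)"
    \<comment> \<open>\<open>dotp_add\<close> and \<open>dotp_scale\<close> act on the first
      argument, so the right-hand side is flipped first.\<close>
    by (subst (3) dotp_commute) (simp add: dotp_add dotp_scale dotp_commute)
  finally show ?case .
qed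

text \<open>Used with \<open>of_rat\<close> to carry annihilation from the rationals to the
  reals.\<close>

lemma polyop_hom:
  fixes h :: "'a::field_char_0 \<Rightarrow> 'b::field_char_0"
  assumes "field_hom h"
  shows "polyop V (\<lambda>i j. h (a i j)) (map_poly h p) (\<lambda>i. h (x i)) = (\<lambda>i. h (polyop V a p x i))"
proof -
  interpret field_hom h by fact
  show ?thesis
    by (induct p) (simp_all add: map_poly_pCons_hom matop_def hom_distribs)
qed

text \<open>With n = |V|, the n + 1 iterates x, Ax, ..., A^n x are linearly dependent; the
  coefficients of a dependency are those of the polynomial.\<close>

lemma finite_annihilator:
  fixes a :: "'i \<Rightarrow> 'i \<Rightarrow> 'a::field"
  assumes "finite V"
  obtains p where "p \<noteq> 0" "\<And>i. i \<in> V \<Longrightarrow> polyop V a p x i = 0"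
proof -
  define n where "n = card V"
  obtain e where e: "bij_betw e {0..<n} V"
    using ex_bij_betw_nat_finite[OF assms] n_def by blast
  \<comment> \<open>Column \<open>k\<close> holds the iterate A^k x. The extra row \<open>n\<close>
    is zero: it makes the matrix square and singular.\<close>
  define M where "M = mat (Suc n) (Suc n) (\<lambda>(i,k). if i < n then (matop V a ^^ k) x (e i) else 0)"
  have M: "M \<in> carrier_mat (Suc n) (Suc n)" by (simp add: M_def)
  \<comment> \<open>Every Leibniz term contains a factor from the zero row.\<close>
  have "(\<Prod>i = 0..<Suc n. M $$ (i, p i)) = 0" if "p permutes {0..<Suc n}" for p
  proof (rule prod_zero)
    have "p n < Suc n" using permutes_in_image[OF that, of n] by simp
    then show "\<exists>i\<in>{0..<Suc n}. M $$ (i, p i) = 0"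
      by (intro bexI[of _ n]) (auto simp: M_def)
  qed simp
  then have "det M = 0"
    unfolding det_def'[OF M] by (intro sum.neutral) auto
  then obtain v where v: "v \<in> carrier_vec (Suc n)" "v \<noteq> 0\<^sub>v (Suc n)" "M *\<^sub>v v = 0\<^sub>v (Suc n)"
    using det_0_iff_vec_prod_zero_field[OF M] by blast
  define p where "p = (\<Sum>k<Suc n. monom (v $ k) k)"
  have cp: "coeff p j = (if j < Suc n then v $ j else 0)" for j
    unfolding p_def coeff_sum_monom ..
  have "p \<noteq> 0"
  proof
    assume "p = 0"
    then have "v $ j = 0" if "j < Suc n" for j using cp[of j] that by simp
    then have "v = 0\<^sub>v (Suc n)" using v(1) by (intro eq_vecI) auto
    with v(2) show False by simp
  qed
  moreover have "polyop V a p x i = 0" if i: "i \<in> V" for i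
  proof -
    obtain k where k: "k < n" "i = e k"
      using bij_betw_imp_surj_on[OF e] i by force
    have "degree p \<le> n" by (rule degree_le) (auto simp: cp)
    then have "polyop V a p x i = (\<Sum>l<Suc n. v $ l * (matop V a ^^ l) x i)"
      by (subst polyop_altdef[of p "Suc n"]) (auto simp: cp intro!: sum.cong)
    also have "\<dots> = (M *\<^sub>v v) $ k"
      using k v(1) by (auto simp: M_def scalar_prod_def atLeast0LessThan mult.commute intro!: sum.cong)
    also have "\<dots> = 0" using v(3) k by simp
    finally show ?thesis .
  qed
  ultimately show ?thesis using that by blast
qed


section \<open>Main eigenvalues of symmetric matrices\<close>

text \<open>Otherwise \<open>f\<close> and \<open>g\<close> would be coprime, and evaluating a
  Bezout identity at the common root \<open>t\<close> would give 0 = 1.\<close>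

lemma irreducible_root_dvd:
  fixes f g :: "rat poly" and t :: "'a::field_char_0"
  assumes "irreducible f" "poly (map_poly of_rat f) t = 0" "poly (map_poly of_rat g) t = 0"
  shows "f dvd g"
proof (rule ccontr)
  assume "\<not> f dvd g"
  then have "\<not> f dvd gcd f g" by simp
  then have "gcd f g dvd 1"
    using irreducibleD'[OF assms(1), of "gcd f g"] by simp
  then have "gcd f g = 1" by (simp only: is_unit_gcd coprime_iff_gcd_eq_1)
  moreover obtain s u where "s * f + u * g = gcd f g"
    using bezout_coefficients by (metis surj_pair)
  ultimately have "map_poly of_rat (s * f + u * g) = (1 :: 'a poly)" by simp
  moreover interpret map_poly_comm_ring_hom "of_rat :: rat \<Rightarrow> 'a" ..
  have "poly (map_poly of_rat (s * f + u * g)) t = 0"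
    using assms(2,3) by (simp add: hom_add hom_mult)
  ultimately show False by simp
qed

text \<open>Take least degree among the nonzero annihilators; up to a scalar this is the minimal
  polynomial of \<open>x\<close> under the matrix.\<close>

lemma minimal_annihilator:
  fixes a :: "'i \<Rightarrow> 'i \<Rightarrow> 'a::field"
  assumes "finite V"
  obtains p where "p \<noteq> 0" "\<And>i. i \<in> V \<Longrightarrow> polyop V a p x i = 0"
    "\<And>q. \<lbrakk>\<And>i. i \<in> V \<Longrightarrow> polyop V a q x i = 0; degree q < degree p\<rbrakk> \<Longrightarrow> q = 0"
proof -
  let ?P = "\<lambda>p. p \<noteq> 0 \<and> (\<forall>i\<in>V. polyop V a p x i = 0)"
  obtain p0 where "?P p0" using finite_annihilator[OF assms] by metis
  from ex_has_least_nat[of ?P, OF this, of degree]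
  obtain p where "?P p" "\<forall>q. ?P q \<longrightarrow> degree p \<le> degree q" by blast
  then show ?thesis using that[of p] by (metis not_less)
qed

text \<open>The quadratic is (X - z)(X - conj z). The remainder modulo it is real and at most
  linear, and vanishing at a nonreal point forces both of its coefficients to be zero.\<close>

lemma nonreal_root_quadratic_dvd:
  fixes p :: "real poly" and z :: complex
  assumes "poly (map_poly of_real p) z = 0" and "Im z \<noteq> 0"
  shows "[:(Re z)\<^sup>2 + (Im z)\<^sup>2, - 2 * Re z, 1:] dvd p"
proof -
  define t where "t = [:(Re z)\<^sup>2 + (Im z)\<^sup>2, - 2 * Re z, 1:]"
  define r where "r = p mod t"
  have "degree r < 2"
    using degree_mod_less'[of t p] by (cases "r = 0") (auto simp: r_def t_def)
  then have "degree r \<le> 1" by simp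
  then obtain c d where r: "r = [:c, d:]"
    by (metis degree1_coeffs degree_0_id le_neq_implies_less less_one pCons_0_0 pCons_0_as_mult)
  have tz: "poly (map_poly of_real t) z = 0"
    by (simp add: t_def complex_eq_iff power2_eq_square algebra_simps)
  have rz: "poly (map_poly of_real r) z = of_real c + z * of_real d"
    unfolding r of_real_hom.map_poly_pCons_hom by simp
  interpret map_poly_comm_ring_hom "of_real :: real \<Rightarrow> complex" ..
  have "map_poly of_real p = (map_poly of_real (t * (p div t) + r) :: complex poly)"
    by (simp add: r_def)
  then have "poly (map_poly of_real r) z = 0"
    using assms(1) tz by (simp add: hom_add hom_mult)
  then have "c + d * Re z = 0" "d * Im z = 0"
    unfolding rz by (simp_all add: complex_eq_iff mult.commute)
  then have "r = 0" using assms(2) r by simp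
  then show ?thesis by (simp add: r_def t_def dvd_eq_mod_eq_0)
qed

text \<open>
  The cyclic subspace generated by \<open>x\<close> contains an eigenvector: apply to \<open>x\<close> the cofactor of a
  linear factor of its minimal annihilating polynomial. Symmetry excludes nonreal roots.
\<close>

lemma exists_eigenvector_not_orthogonal:
  fixes a :: "'i \<Rightarrow> 'i \<Rightarrow> real"
  assumes fin: "finite V" and sym: "\<And>i j. i \<in> V \<Longrightarrow> j \<in> V \<Longrightarrow> a i j = a j i"
    and nz: "i0 \<in> V" "x i0 \<noteq> 0"
  obtains \<theta> v where "\<And>i. i \<in> V \<Longrightarrow> matop V a v i = \<theta> * v i" "dotp V v x \<noteq> 0"
proof -
  obtain p where p: "p \<noteq> 0" "\<And>i. i \<in> V \<Longrightarrow> polyop V a p x i = 0"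
    and min: "\<And>q. \<lbrakk>\<And>i. i \<in> V \<Longrightarrow> polyop V a q x i = 0; degree q < degree p\<rbrakk> \<Longrightarrow> q = 0"
    using minimal_annihilator[OF fin] by metis
  have "degree p \<noteq> 0"
  proof
    assume "degree p = 0"
    then obtain c where "p = [:c:]" by (rule degree_eq_zeroE)
    with p(2)[OF nz(1)] p(1) nz(2) show False by simp
  qed
  then have "\<not> constant (poly (map_poly of_real p :: complex poly))"
    by (simp add: constant_degree degree_map_poly)
  then obtain z :: complex where z: "poly (map_poly of_real p) z = 0"
    using fundamental_theorem_of_algebra by blast
  \<comment> \<open>A proper cofactor has smaller degree than \<open>p\<close>, so by minimality it
    cannot annihilate \<open>x\<close>.\<close>
  have cofactor: "\<exists>i\<in>V. polyop V a q x i \<noteq> 0" if "p = t * q" "degree t > 0" for t q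
  proof (rule ccontr)
    assume "\<not> ?thesis"
    moreover have "q \<noteq> 0" "t \<noteq> 0" using that p(1) by auto
    then have "degree q < degree p" using that by (simp add: degree_mult_eq)
    ultimately show False using min[of q] \<open>q \<noteq> 0\<close> by blast
  qed
  have "Im z = 0"
  proof (rule ccontr)
    assume "Im z \<noteq> 0"
    from nonreal_root_quadratic_dvd[OF z this]
    obtain q where q: "p = [:(Re z)\<^sup>2 + (Im z)\<^sup>2, - 2 * Re z, 1:] * q" by (rule dvdE)
    define w where "w = polyop V a q x"
    \<comment> \<open>Completing the square: the quadratic is \<open>l * l\<close> plus the positive
      constant (Im z)^2. By self-adjointness |l(A)w|^2 + (Im z)^2 |w|^2 = 0, so \<open>w\<close>
      vanishes on \<open>V\<close>.\<close>
    define l where "l = [:- Re z, 1:]"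
    obtain i1 where i1: "i1 \<in> V" "w i1 \<noteq> 0"
      using cofactor[OF q] by (auto simp: w_def)
    have "p = (l * l + [:(Im z)\<^sup>2:]) * q"
      unfolding q l_def by (simp add: power2_eq_square)
    then have 0: "polyop V a (l * l) w i + (Im z)\<^sup>2 * w i = 0" if "i \<in> V" for i
      using p(2)[OF that] by (simp add: polyop_mult polyop_add w_def)
    have "dotp V (polyop V a l w) (polyop V a l w) + (Im z)\<^sup>2 * dotp V w w
        = dotp V w (polyop V a (l * l) w) + (Im z)\<^sup>2 * dotp V w w"
      using polyop_adjoint[where V = V and a = a and p = l and x = w and y = "polyop V a l w"] sym
      by (simp add: polyop_mult)
    also have "\<dots> = dotp V (\<lambda>i. polyop V a (l * l) w i + (Im z)\<^sup>2 * w i) w"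
      by (simp add: dotp_add dotp_scale dotp_commute[of V w "polyop V a (l * l) w"])
    also have "\<dots> = 0" using 0 by (subst dotp_commute, intro dotp_zero) simp
    finally have "(Im z)\<^sup>2 * dotp V w w \<le> 0"
      using sum_nonneg[of V "\<lambda>i. polyop V a l w i * polyop V a l w i"]
      by (simp add: dotp_def)
    then have "dotp V w w \<le> 0"
      using \<open>Im z \<noteq> 0\<close> by (simp add: mult_le_0_iff)
    then show False using dotp_self_eq_0[OF fin _ i1(1)] i1(2) by blast
  qed
  then have "z = of_real (Re z)" by (simp add: complex_eq_iff)
  with z have "poly p (Re z) = 0"
    by (metis of_real_eq_0_iff of_real_hom.poly_map_poly)
  then obtain q where q: "p = [:- Re z, 1:] * q"
    by (auto simp: poly_eq_0_iff_dvd)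
  define v where "v = polyop V a q x"
  obtain i1 where i1: "i1 \<in> V" "v i1 \<noteq> 0"
    using cofactor[OF q] by (auto simp: v_def)
  have eig: "matop V a v i = Re z * v i" if "i \<in> V" for i
    using p(2)[OF that] unfolding q polyop_mult v_def[symmetric] by simp
  \<comment> \<open>As v = q(A)x on \<open>V\<close>, moving q(A) across gives |v|^2 = q(Re z)
    <v,x>. Orthogonality to \<open>x\<close> would make \<open>v\<close> vanish.\<close>
  have "dotp V v v = dotp V x (polyop V a q v)"
    by (subst v_def) (rule polyop_adjoint[OF sym])
  also have "\<dots> = dotp V x (\<lambda>i. poly q (Re z) * v i)"
    using polyop_eigenvector[OF eig] by (intro dotp_cong) auto
  also have "\<dots> = poly q (Re z) * dotp V v x"
    by (subst dotp_commute) (rule dotp_scale)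
  finally have "dotp V v x \<noteq> 0"
    using dotp_self_eq_0[OF fin _ i1(1), of v] i1(2) by auto
  with eig show ?thesis using that by blast
qed

text \<open>
  Minimality passes from the rationals to the reals because the Gram matrix of the iterates
  of \<open>x\<close> has a rational determinant.
\<close>

lemma real_annihilator_degree:
  fixes a :: "'i \<Rightarrow> 'i \<Rightarrow> rat" and x :: "'i \<Rightarrow> rat" and r :: "real poly"
  defines "aR \<equiv> \<lambda>i j. of_rat (a i j)" and "xR \<equiv> \<lambda>i. of_rat (x i)"
  assumes fin: "finite V"
    and min: "\<And>q. \<lbrakk>\<And>i. i \<in> V \<Longrightarrow> polyop V a q x i = 0; degree q < d\<rbrakk> \<Longrightarrow> q = 0"
    and r: "\<And>i. i \<in> V \<Longrightarrow> polyop V aR r xR i = 0" "degree r < d"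
  shows "r = 0"
proof (rule ccontr)
  assume "r \<noteq> 0"
  define y where "y k = (matop V a ^^ k) x" for k
  have iter: "(matop V aR ^^ k) xR = (\<lambda>i. of_rat (y k i))" for k
    by (induct k) (simp_all add: y_def aR_def xR_def matop_def of_rat_sum of_rat_mult)
  \<comment> \<open>The rational Gram matrix of the first \<open>d\<close> iterates. The
    coefficients of \<open>r\<close> lie in the kernel of its real version, so its determinant is
    zero over either field.\<close>
  define M where "M = mat d d (\<lambda>(k,l). dotp V (y k) (y l))"
  have M: "M \<in> carrier_mat d d" by (simp add: M_def)
  define MR where "MR = map_mat (of_rat :: rat \<Rightarrow> real) M"
  have MR: "MR \<in> carrier_mat d d" using M by (simp add: MR_def)
  define c where "c = vec d (coeff r)"
  have "MR *\<^sub>v c = 0\<^sub>v d"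
  proof (rule eq_vecI)
    fix k assume "k < dim_vec (0\<^sub>v d :: real vec)"
    then have k: "k < d" by simp
    have "(MR *\<^sub>v c) $ k = (\<Sum>l<d. coeff r l * dotp V (\<lambda>i. of_rat (y k i)) (\<lambda>i. of_rat (y l i)))"
      using k by (auto simp: MR_def M_def c_def scalar_prod_def atLeast0LessThan dotp_def of_rat_sum
          of_rat_mult mult.commute intro!: sum.cong)
    also have "\<dots> = dotp V (\<lambda>i. of_rat (y k i)) (\<lambda>i. \<Sum>l<d. coeff r l * of_rat (y l i))"
      by (rule dotp_sum[symmetric])
    also have "\<dots> = 0"
      using r(1) unfolding polyop_altdef[OF r(2)] iter by (intro dotp_zero) simp
    finally show "(MR *\<^sub>v c) $ k = 0\<^sub>v d $ k" using k by simp
  qed (use MR in simp)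
  moreover have "c \<noteq> 0\<^sub>v d"
  proof
    assume "c = 0\<^sub>v d"
    then have "c $ degree r = 0" using r(2) by simp
    then show False using r(2) \<open>r \<noteq> 0\<close> by (simp add: c_def)
  qed
  moreover have "c \<in> carrier_vec d" by (simp add: c_def)
  ultimately have "det MR = 0"
    using det_0_iff_vec_prod_zero_field[OF MR] by blast
  then have "det M = 0" unfolding MR_def of_rat_hom.hom_det by simp
  then obtain w where w: "w \<in> carrier_vec d" "w \<noteq> 0\<^sub>v d" "M *\<^sub>v w = 0\<^sub>v d"
    using det_0_iff_vec_prod_zero_field[OF M] by blast
  define q where "q = (\<Sum>k<d. monom (w $ k) k)"
  have cq: "coeff q j = (if j < d then w $ j else 0)" for j
    unfolding q_def coeff_sum_monom ..
  \<comment> \<open>Needed for the strict bound on \<open>degree q\<close>, since even the zero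
    polynomial has degree 0.\<close>
  have "d > 0" using r(2) by simp
  have "degree q \<le> d - 1" by (rule degree_le) (auto simp: cq)
  then have dq: "degree q < d" using \<open>d > 0\<close> by simp
  define u where "u = polyop V a q x"
  have u: "u = (\<lambda>i. \<Sum>k<d. w $ k * y k i)"
    unfolding u_def polyop_altdef[OF dq] y_def[symmetric] by (simp add: cq)
  \<comment> \<open>The rational kernel vector makes \<open>u\<close> orthogonal to every iterate.
    As \<open>u\<close> is a combination of these iterates, it is orthogonal to itself.\<close>
  have "dotp V (y k) u = 0" if "k < d" for k
  proof -
    have "dotp V (y k) u = (\<Sum>l<d. w $ l * dotp V (y k) (y l))"
      unfolding u by (rule dotp_sum)
    also have "\<dots> = (M *\<^sub>v w) $ k"
      using that w(1) by (auto simp: M_def scalar_prod_def atLeast0LessThan mult.commute intro!: sum.cong)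
    also have "\<dots> = 0" using w(3) that by simp
    finally show ?thesis .
  qed
  then have "dotp V u (\<lambda>i. \<Sum>k<d. w $ k * y k i) = 0"
    unfolding dotp_sum by (simp add: dotp_commute[of V u])
  then have "dotp V u u = 0" unfolding u .
  then have "q = 0"
    using min[OF _ dq] dotp_self_eq_0[OF fin, of u] by (simp add: u_def)
  then have "w = 0\<^sub>v d" using cq w(1) by (intro eq_vecI) (auto, metis coeff_0)
  with w(2) show False by simp
qed

text \<open>Main eigenvalues with \<open>x\<close> in the role of the all-one vector. The nonzero
  product already makes \<open>v\<close> nonzero on \<open>V\<close>.\<close>

definition main_value :: "'i set \<Rightarrow> ('i \<Rightarrow> 'i \<Rightarrow> real) \<Rightarrow> ('i \<Rightarrow> real) \<Rightarrow> real \<Rightarrow> bool" where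
  "main_value V a x \<theta> \<longleftrightarrow>
     (\<exists>v. (\<forall>i\<in>V. matop V a v i = \<theta> * v i) \<and> dotp V v x \<noteq> 0)"

text \<open>For an eigenvector \<open>v\<close> witnessing \<theta>, p(\<theta>) <v,x> = <p(A)v,x> =
  <v,p(A)x> = 0.\<close>

lemma main_value_root:
  assumes "main_value V a x \<theta>" and sym: "\<And>i j. i \<in> V \<Longrightarrow> j \<in> V \<Longrightarrow> a i j = a j i"
    and "\<And>i. i \<in> V \<Longrightarrow> polyop V a p x i = 0"
  shows "poly p \<theta> = 0"
proof -
  obtain v where v: "\<And>i. i \<in> V \<Longrightarrow> matop V a v i = \<theta> * v i" "dotp V v x \<noteq> 0"
    using assms(1) by (auto simp: main_value_def)
  have "poly p \<theta> * dotp V v x = dotp V (\<lambda>i. poly p \<theta> * v i) x"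
    by (rule dotp_scale[symmetric])
  also have "\<dots> = dotp V (polyop V a p v) x"
    using polyop_eigenvector[OF v(1)] by (intro dotp_cong) auto
  also have "\<dots> = dotp V v (polyop V a p x)" by (rule polyop_adjoint[OF sym])
  also have "\<dots> = 0" using assms(3) by (rule dotp_zero)
  finally show ?thesis using v(2) by simp
qed

text \<open>All of them are roots of one nonzero annihilator. Finiteness matters because a product
  over an infinite set defaults to 1.\<close>

lemma finite_main_values:
  assumes "finite V" and "\<And>i j. i \<in> V \<Longrightarrow> j \<in> V \<Longrightarrow> a i j = a j i"
  shows "finite {\<theta>. main_value V a x \<theta>}"
proof -
  obtain p where p: "p \<noteq> 0" "\<And>i. i \<in> V \<Longrightarrow> polyop V a p x i = 0"
    using finite_annihilator[OF assms(1)] by metis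
  have "{\<theta>. main_value V a x \<theta>} \<subseteq> {\<theta>. poly p \<theta> = 0}"
    using main_value_root[OF _ assms(2) p(2)] by auto
  then show ?thesis using poly_roots_finite[OF p(1)] finite_subset by blast
qed

text \<open>If P(A)x were nonzero, some eigenvector \<open>v\<close> would not be orthogonal to it.
  Since <v,P(A)x> = P(\<theta>) <v,x>, its eigenvalue \<theta> would be a main value and yet not a
  root of P.\<close>

lemma main_polynomial_annihilates:
  assumes fin: "finite V" and sym: "\<And>i j. i \<in> V \<Longrightarrow> j \<in> V \<Longrightarrow> a i j = a j i" and "i \<in> V"
  shows "polyop V a (\<Prod>\<theta> | main_value V a x \<theta>. [:- \<theta>, 1:]) x i = 0"
proof (rule ccontr)
  define P where "P = (\<Prod>\<theta> | main_value V a x \<theta>. [:- \<theta>, 1:])"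
  assume "polyop V a (\<Prod>\<theta> | main_value V a x \<theta>. [:- \<theta>, 1:]) x i \<noteq> 0"
  then have "polyop V a P x i \<noteq> 0" by (simp only: P_def not_False_eq_True)
  then have "\<exists>\<theta> v. (\<forall>i\<in>V. matop V a v i = \<theta> * v i) \<and> dotp V v (polyop V a P x) \<noteq> 0"
    using exists_eigenvector_not_orthogonal[where V = V and a = a, OF fin _ \<open>i \<in> V\<close>] sym
    by metis
  then obtain \<theta> v where v: "\<And>i. i \<in> V \<Longrightarrow> matop V a v i = \<theta> * v i"
    "dotp V v (polyop V a P x) \<noteq> 0"
    by blast
  have "dotp V v (polyop V a P x) = dotp V (polyop V a P v) x"
    by (rule polyop_adjoint[OF sym, symmetric])
  also have "\<dots> = dotp V (\<lambda>i. poly P \<theta> * v i) x"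
    using polyop_eigenvector[OF v(1)] by (intro dotp_cong) auto
  also have "\<dots> = poly P \<theta> * dotp V v x" by (rule dotp_scale)
  finally have "dotp V v x \<noteq> 0" "poly P \<theta> \<noteq> 0" using v(2) by auto
  then have "main_value V a x \<theta>" using v(1) by (auto simp: main_value_def)
  moreover have "finite {\<theta>. main_value V a x \<theta>}"
    using fin sym by (rule finite_main_values)
  ultimately have "poly P \<theta> = 0"
    by (auto simp: P_def poly_prod)
  with \<open>poly P \<theta> \<noteq> 0\<close> show False by simp
qed

text \<open>The rational minimal annihilator \<open>p\<close> of \<open>x\<close> lies between the
  two: \<open>f\<close> divides it because they share the root \<theta>, and it divides the main
  polynomial because the remainder is a real annihilator of too small a degree.\<close>

lemma irreducible_dvd_main_polynomial:
  fixes a :: "'i \<Rightarrow> 'i \<Rightarrow> rat" and x :: "'i \<Rightarrow> rat" and f :: "rat poly"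
  defines "aR \<equiv> \<lambda>i j. of_rat (a i j)" and "xR \<equiv> \<lambda>i. of_rat (x i)"
  assumes fin: "finite V" and sym: "\<And>i j. i \<in> V \<Longrightarrow> j \<in> V \<Longrightarrow> a i j = a j i"
    and f: "irreducible f" "poly (map_poly of_rat f) \<theta> = 0" and main: "main_value V aR xR \<theta>"
  shows "map_poly of_rat f dvd (\<Prod>\<theta> | main_value V aR xR \<theta>. [:- \<theta>, 1:])"
proof -
  interpret h: map_poly_comm_ring_hom "of_rat :: rat \<Rightarrow> real" ..
  define P where "P = (\<Prod>\<theta> | main_value V aR xR \<theta>. [:- \<theta>, 1:])"
  have symR: "aR i j = aR j i" if "i \<in> V" "j \<in> V" for i j
    using sym[OF that] by (simp add: aR_def)
  obtain p where p: "p \<noteq> 0" "\<And>i. i \<in> V \<Longrightarrow> polyop V a p x i = 0"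
    and min: "\<And>q. \<lbrakk>\<And>i. i \<in> V \<Longrightarrow> polyop V a q x i = 0; degree q < degree p\<rbrakk> \<Longrightarrow> q = 0"
    using minimal_annihilator[OF fin] by metis
  let ?p = "map_poly of_rat p :: real poly"
  have pR: "polyop V aR ?p xR i = 0" if "i \<in> V" for i
    unfolding aR_def xR_def polyop_hom[OF of_rat_hom.field_hom_axioms] by (simp add: p(2)[OF that])
  have "poly ?p \<theta> = 0" by (rule main_value_root[OF main symR pR])
  then have "f dvd p" by (rule irreducible_root_dvd[OF f])
  then have "map_poly of_rat f dvd ?p" by (rule h.hom_dvd)
  also have "?p dvd P"
  proof -
    define r where "r = P mod ?p"
    have p0: "?p \<noteq> 0" using p(1) by simp
    have P: "P = (P div ?p) * ?p + r"
      unfolding r_def by (rule div_mult_mod_eq[symmetric])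
    have r0: "polyop V aR r xR i = 0" if "i \<in> V" for i
    proof -
      have "polyop V aR (P div ?p * ?p) xR i = 0"
        unfolding polyop_mult using pR that by (rule polyop_vanish)
      moreover have "polyop V aR P xR i = 0"
        unfolding P_def by (rule main_polynomial_annihilates[OF fin symR that])
      ultimately show ?thesis
        using fun_cong[OF polyop_add[of V aR "P div ?p * ?p" r xR], of i]
        unfolding P[symmetric] by simp
    qed
    have "r = 0"
    proof (cases "degree r < degree p")
      case True
      then show ?thesis
        by (intro real_annihilator_degree[where V = V and a = a and x = x, OF fin min])
          (use r0 in \<open>simp_all add: aR_def xR_def\<close>)
    next
      case False
      then show ?thesis using degree_mod_less'[OF p0, of P] by (auto simp: r_def)
    qed
    then show ?thesis by (simp add: r_def dvd_eq_mod_eq_0)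
  qed
  finally show ?thesis unfolding P_def .
qed


section \<open>Characteristic polynomials and components of graphs\<close>

text \<open>The arbitrary enumeration has the same form as in \<open>vertex_enum\<close>, so for a
  vertex set this is \<open>graph_char_poly\<close> by mere unfolding.\<close>

definition set_char_poly :: "'i set \<Rightarrow> ('i \<Rightarrow> 'i \<Rightarrow> 'a::comm_ring_1) \<Rightarrow> 'a poly" where
  "set_char_poly V a = (let e = SOME e. bij_betw e {0..<card V} V in
     char_poly (mat (card V) (card V) (\<lambda>(i,j). a (e i) (e j))))"

text \<open>Permuting the rows and, via the transpose, the columns contributes the sign of
  \<open>p\<close> twice.\<close>

lemma det_permute_rows_columns:
  fixes M :: "'a::comm_ring_1 mat"
  assumes M: "M \<in> carrier_mat n n" and p: "p permutes {0..<n}"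
  shows "det (mat n n (\<lambda>(i,j). M $$ (p i, p j))) = det M"
proof -
  have pn: "p i < n" if "i < n" for i
    using permutes_in_image[OF p, of i] that by simp
  define N where "N = mat n n (\<lambda>(i,j). M $$ (i, p j))"
  have N: "N \<in> carrier_mat n n" by (simp add: N_def)
  have "mat n n (\<lambda>(i,j). M $$ (p i, p j)) = mat n n (\<lambda>(i,j). N $$ (p i, j))"
    by (rule eq_matI) (auto simp: N_def pn)
  then have "det (mat n n (\<lambda>(i,j). M $$ (p i, p j))) = signof p * det N"
    by (simp only: det_permute_rows[OF N p])
  also have "transpose_mat N = mat n n (\<lambda>(i,j). transpose_mat M $$ (p i, j))"
    using M by (intro eq_matI) (auto simp: N_def pn)
  then have "det N = signof p * det M"
    using det_permute_rows[of "transpose_mat M" n p] M p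
    by (metis N det_transpose transpose_carrier_mat)
  also have "signof p * (signof p * det M) = det M"
    by (cases p rule: sign_cases) simp_all
  finally show ?thesis .
qed

lemma char_poly_enumeration:
  fixes a :: "'i \<Rightarrow> 'i \<Rightarrow> 'a::comm_ring_1"
  assumes e: "bij_betw e {0..<n} V" and e': "bij_betw e' {0..<n} V"
  shows "char_poly (mat n n (\<lambda>(i,j). a (e' i) (e' j))) = char_poly (mat n n (\<lambda>(i,j). a (e i) (e j)))"
proof -
  define q where "q = inv_into {0..<n} e \<circ> e'"
  \<comment> \<open>The change of enumeration, extended by the identity because
    \<open>permutes\<close> fixes everything outside the range.\<close>
  define p where "p i = (if i \<in> {0..<n} then q i else i)" for i
  have q: "bij_betw q {0..<n} {0..<n}"
    unfolding q_def by (rule bij_betw_trans[OF e' bij_betw_inv_into[OF e]])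
  have "bij_betw p {0..<n} {0..<n}"
    using q by (subst bij_betw_cong[of _ _ q]) (auto simp: p_def)
  then have p: "p permutes {0..<n}"
    by (rule bij_imp_permutes) (simp add: p_def)
  have pn: "p i < n" if "i < n" for i
    using permutes_in_image[OF p, of i] that by simp
  have ep: "e' i = e (p i)" if "i < n" for i
    using that e' by (auto simp: p_def q_def bij_betw_inv_into_right[OF e] bij_betw_apply)
  have inj: "p i = p j \<longleftrightarrow> i = j" for i j
    using permutes_inj[OF p] by (auto dest: injD)
  let ?M = "char_poly_matrix (mat n n (\<lambda>(i,j). a (e i) (e j)))"
  have "char_poly_matrix (mat n n (\<lambda>(i,j). a (e' i) (e' j))) = mat n n (\<lambda>(i,j). ?M $$ (p i, p j))"
    by (rule eq_matI) (auto simp: char_poly_matrix_def pn ep inj)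
  then show ?thesis
    unfolding char_poly_def by (subst det_permute_rows_columns[OF _ p, symmetric, where M = ?M]) auto
qed

lemma set_char_poly_eq:
  assumes "bij_betw e {0..<card V} V"
  shows "set_char_poly V a = char_poly (mat (card V) (card V) (\<lambda>(i,j). a (e i) (e j)))"
  unfolding set_char_poly_def Let_def
  by (rule char_poly_enumeration[OF assms
        someI[where P = "\<lambda>e. bij_betw e {0..<card V} V", OF assms]])

lemma set_char_poly_cong:
  assumes "finite V" and "\<And>u v. u \<in> V \<Longrightarrow> v \<in> V \<Longrightarrow> a u v = b u v"
  shows "set_char_poly V a = set_char_poly V b"
proof -
  obtain e where e: "bij_betw e {0..<card V} V"
    using ex_bij_betw_nat_finite[OF assms(1)] by blast
  have "mat (card V) (card V) (\<lambda>(i,j). a (e i) (e j)) = mat (card V) (card V) (\<lambda>(i,j). b (e i) (e j))"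
    using e assms(2) by (intro eq_matI) (auto simp: bij_betw_apply)
  then show ?thesis by (simp only: set_char_poly_eq[OF e])
qed

lemma set_char_poly_empty: "set_char_poly {} a = 1"
  by (simp add: set_char_poly_def Let_def char_poly_def det_dim_zero)

text \<open>Listing \<open>V\<close> before \<open>W\<close> makes the matrix block lower
  triangular, so the determinant is the product over the diagonal blocks.\<close>

lemma set_char_poly_Un:
  fixes a :: "'i \<Rightarrow> 'i \<Rightarrow> 'a::idom"
  assumes fin: "finite V" "finite W" and disj: "V \<inter> W = {}"
    and zero: "\<And>v w. v \<in> V \<Longrightarrow> w \<in> W \<Longrightarrow> a v w = 0"
  shows "set_char_poly (V \<union> W) a = set_char_poly V a * set_char_poly W a"
proof -
  define n m where "n = card V" and "m = card W"
  obtain e1 where e1: "bij_betw e1 {0..<n} V"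
    using ex_bij_betw_nat_finite[OF fin(1)] n_def by blast
  obtain e2 where e2: "bij_betw e2 {0..<m} W"
    using ex_bij_betw_nat_finite[OF fin(2)] m_def by blast
  define e where "e i = (if i < n then e1 i else e2 (i - n))" for i
  have card: "card (V \<union> W) = n + m"
    using fin disj by (simp add: card_Un_disjoint n_def m_def)
  have "bij_betw e {0..<n} V"
    using e1 by (subst bij_betw_cong[of _ _ e1]) (auto simp: e_def)
  moreover have "bij_betw (\<lambda>i. i - n) {n..<n + m} {0..<m}"
    by (rule bij_betw_byWitness[where f' = "\<lambda>i. i + n"]) auto
  from bij_betw_trans[OF this e2] have "bij_betw e {n..<n + m} W"
    by (subst bij_betw_cong[of _ _ "e2 \<circ> (\<lambda>i. i - n)"]) (auto simp: e_def)
  ultimately have "bij_betw e ({0..<n} \<union> {n..<n + m}) (V \<union> W)"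
    using disj by (rule bij_betw_combine)
  moreover have "{0..<n} \<union> {n..<n + m} = {0..<card (V \<union> W)}" using card by auto
  ultimately have e: "bij_betw e {0..<card (V \<union> W)} (V \<union> W)" by simp
  let ?A1 = "char_poly_matrix (mat n n (\<lambda>(i,j). a (e1 i) (e1 j)))"
  let ?A4 = "char_poly_matrix (mat m m (\<lambda>(i,j). a (e2 i) (e2 j)))"
  let ?A3 = "mat m n (\<lambda>(i,j). [:- a (e2 i) (e1 j):])"
  have 0: "a (e1 i) (e2 j) = 0" if "i < n" "j < m" for i j
    using that zero bij_betw_apply[OF e1, of i] bij_betw_apply[OF e2, of j] by simp
  have "char_poly_matrix (mat (n + m) (n + m) (\<lambda>(i,j). a (e i) (e j)))
      = four_block_mat ?A1 (0\<^sub>m n m) ?A3 ?A4"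
    by (rule eq_matI) (auto simp: char_poly_matrix_def four_block_mat_def e_def 0)
  then have "det (char_poly_matrix (mat (n + m) (n + m) (\<lambda>(i,j). a (e i) (e j)))) = det ?A1 * det ?A4"
    using det_four_block_mat_upper_right_zero[of ?A1 n "0\<^sub>m n m" m ?A3 ?A4] by simp
  moreover have "set_char_poly V a = det ?A1" "set_char_poly W a = det ?A4"
    using set_char_poly_eq[of e1 V a] set_char_poly_eq[of e2 W a] e1 e2
    by (simp_all only: n_def m_def char_poly_def)
  moreover have "set_char_poly (V \<union> W) a = det (char_poly_matrix (mat (n + m) (n + m) (\<lambda>(i,j). a (e i) (e j))))"
    using set_char_poly_eq[OF e, of a] by (simp only: card char_poly_def)
  ultimately show ?thesis by (simp only:)
qed

lemma set_char_poly_UN: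
  fixes a :: "'i \<Rightarrow> 'i \<Rightarrow> 'a::idom"
  assumes "finite K" "\<And>k. k \<in> K \<Longrightarrow> finite (V k)"
    and "\<And>k l. k \<in> K \<Longrightarrow> l \<in> K \<Longrightarrow> k \<noteq> l \<Longrightarrow> V k \<inter> V l = {}"
    and "\<And>k l v w. k \<in> K \<Longrightarrow> l \<in> K \<Longrightarrow> k \<noteq> l \<Longrightarrow> v \<in> V k \<Longrightarrow> w \<in> V l \<Longrightarrow> a v w = 0"
  shows "set_char_poly (\<Union>k\<in>K. V k) a = (\<Prod>k\<in>K. set_char_poly (V k) a)"
  using assms
proof (induct K)
  case empty
  show ?case by (simp add: set_char_poly_empty)
next
  case (insert k K)
  have "set_char_poly (V k \<union> (\<Union>l\<in>K. V l)) a = set_char_poly (V k) a * set_char_poly (\<Union>l\<in>K. V l) a"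
  proof (rule set_char_poly_Un)
    show "finite (V k)" "finite (\<Union>l\<in>K. V l)" using insert.hyps(1) insert.prems(1) by auto
    show "V k \<inter> (\<Union>l\<in>K. V l) = {}"
      using insert.hyps(2) insert.prems(2)[of k] by blast
    show "a v w = 0" if "v \<in> V k" "w \<in> (\<Union>l\<in>K. V l)" for v w
      using that insert.hyps(2) insert.prems(3)[of k _ v w] by blast
  qed
  moreover have "set_char_poly (\<Union>l\<in>K. V l) a = (\<Prod>l\<in>K. set_char_poly (V l) a)"
    by (rule insert.hyps(3)) (use insert.prems in blast)+
  ultimately show ?case using insert.hyps by simp
qed

section \<open>Adjacency matrices and their characteristic polynomials\<close>

definition adjacency :: "('a,'b) pre_digraph \<Rightarrow> 'a \<Rightarrow> 'a \<Rightarrow> 'c::zero_neq_one" where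
  "adjacency G u v = (if u \<rightarrow>\<^bsub>G\<^esub> v then 1 else 0)"

lemma vertex_enum_bij: "finite (verts G) \<Longrightarrow> bij_betw (vertex_enum G) {0..<card (verts G)} (verts G)"
  unfolding vertex_enum_def by (rule someI_ex[OF ex_bij_betw_nat_finite])

lemma adj_matrix_altdef:
  "adj_matrix G = mat (card (verts G)) (card (verts G))
     (\<lambda>(i,j). adjacency G (vertex_enum G i) (vertex_enum G j))"
  by (simp add: adj_matrix_def adjacency_def)

lemma adj_matrix_carrier: "adj_matrix G \<in> carrier_mat (card (verts G)) (card (verts G))"
  by (simp add: adj_matrix_def)

lemma graph_char_poly_altdef: "graph_char_poly G = set_char_poly (verts G) (adjacency G)"
  by (simp add: graph_char_poly_def adj_matrix_altdef set_char_poly_def vertex_enum_def Let_def)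

lemma adj_matrix_of_rat: "map_mat of_rat (adj_matrix G) = (adj_matrix G :: 'a::field_char_0 mat)"
  by (rule eq_matI) (auto simp: adj_matrix_def)

text \<open>Links the rational characteristic polynomial to the real matrix in which main
  eigenvalues live.\<close>

lemma char_poly_adj_matrix:
  "char_poly (adj_matrix G :: 'a::field_char_0 mat) = map_poly of_rat (graph_char_poly G)"
  using of_rat_hom.char_poly_hom[OF adj_matrix_carrier, of G]
  by (simp only: adj_matrix_of_rat graph_char_poly_def)

lemma main_eigenvalue_root:
  assumes "main_eigenvalue G \<theta>"
  shows "poly (map_poly of_rat (graph_char_poly G)) \<theta> = 0"
proof -
  have "eigenvalue (adj_matrix G) \<theta>"
    using assms by (auto simp: main_eigenvalue_def eigenvalue_def)
  then show ?thesis
    by (simp add: eigenvalue_root_char_poly[OF adj_matrix_carrier] char_poly_adj_matrix)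
qed

section \<open>Connected components of symmetric digraphs\<close>

context sym_digraph
begin

lemma sym_digraph_induced:
  assumes "induced_subgraph c G"
  shows "sym_digraph c"
proof -
  interpret c: wf_digraph c using assms by (rule wf_digraphI_induced)
  show ?thesis
    by unfold_locales (rule induced_graph_imp_symmetric[OF sym_arcs assms])
qed

lemma connected_iff_strongly_connected: "connected G \<longleftrightarrow> strongly_connected G"
proof
  assume "strongly_connected G"
  then show "connected G"
    unfolding connected_def strongly_connected_def
    by (simp add: reachable_mk_symmetric_eq[OF sym_arcs])
qed (rule symmetric_connected_imp_strongly_connected[OF sym_arcs])

text \<open>Gives the components the known facts on strongly connected components: they cover the
  vertices, are disjoint and are induced.\<close>

lemma components_eq_sccs: "components G = sccs"
proof
  show "components G \<subseteq> sccs"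
  proof
    fix c assume "c \<in> components G"
    then have c: "max_subgraph connected c" by (simp add: components_def)
    \<comment> \<open>Adding arcs on the same vertices keeps a graph connected, so a maximal
      connected subgraph is induced.\<close>
    have "arc_mono connected"
      unfolding arc_mono_def
      by (metis spanning_def subgraphE wf_digraph.connected_spanning_imp_connected)
    with c have "induced_subgraph c G" by (rule induced_subgraphI_arc_mono)
    then have "strongly_connected c"
      using max_subgraph_prop[OF c] sym_digraph.connected_iff_strongly_connected[of c]
        sym_digraph_induced by blast
    moreover have False if "strongly_connected d" "c \<noteq> d" "subgraph c d" "subgraph d G" for d
    proof -
      \<comment> \<open>A subgraph \<open>d\<close> need not be symmetric, but the induced subgraph
        on its vertices is, and there both notions of connectedness agree. Maximality of
        \<open>c\<close> then leaves no room for \<open>d\<close>.\<close>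
      let ?K = "G \<restriction> verts d"
      have K: "induced_subgraph ?K G" "subgraph d ?K" "strongly_connected ?K"
        using that induced_induce subgraph_induce_subgraphI2[of d G]
          strongly_connected_imp_induce_subgraph_strongly_connected[of d] by auto
      then have "connected ?K"
        using sym_digraph.connected_iff_strongly_connected[of ?K] sym_digraph_induced by blast
      then have "?K = c"
        using c K(1,2) that(3) subgraph_trans[of c d ?K] unfolding max_subgraph_def
        by (metis induced_imp_subgraph)
      then show False
        using K(2) that(2,3) by (auto simp: subgraph_def compatible_def)
    qed
    ultimately have "max_subgraph strongly_connected c"
      using c by (intro max_subgraphI) (auto simp: max_subgraph_def)
    then show "c \<in> sccs" by (simp add: sccs_altdef2)
  qed
  show "sccs \<subseteq> components G"
  proof
    fix c assume c_scc: "c \<in> sccs"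
    then have c: "max_subgraph strongly_connected c" by (simp add: sccs_altdef2)
    have "connected c"
      using c_scc sym_digraph.connected_iff_strongly_connected[of c] sym_digraph_induced by auto
    moreover have False if "connected d" "c \<noteq> d" "subgraph c d" "subgraph d G" for d
    proof -
      let ?K = "G \<restriction> verts d"
      have K: "induced_subgraph ?K G" "subgraph d ?K"
        using that induced_induce subgraph_induce_subgraphI2[of d G] by auto
      \<comment> \<open>Here connectedness passes from \<open>d\<close> to the induced subgraph
        because \<open>d\<close> spans it.\<close>
      then have "spanning d ?K" by (auto simp: spanning_def)
      then have "connected ?K"
        using that(1) wf_digraph.connected_spanning_imp_connected wellformed_induce_subgraph by blast
      then have "strongly_connected ?K"
        using K(1) sym_digraph.connected_iff_strongly_connected[of ?K] sym_digraph_induced by blast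
      then have "?K = c"
        using c K that(3) subgraph_trans[of c d ?K] unfolding max_subgraph_def
        by (metis induced_imp_subgraph)
      then show False
        using K(2) that(2,3) by (auto simp: subgraph_def compatible_def)
    qed
    ultimately show "c \<in> components G"
      using c unfolding components_def by (auto intro!: max_subgraphI simp: max_subgraph_def)
  qed
qed

text \<open>By symmetry an arc makes its two ends mutually reachable.\<close>

lemma component_closed:
  assumes "c \<in> components G" and "u \<in> verts c" and "u \<rightarrow> v"
  shows "v \<in> verts c"
proof (rule ccontr)
  assume "v \<notin> verts c"
  moreover have "verts c \<in> sccs_verts"
    using assms(1) by (auto simp: components_eq_sccs sccs_verts_conv)
  ultimately have "\<not> u \<rightarrow>\<^sup>* v \<or> \<not> v \<rightarrow>\<^sup>* u"
    using assms(2) by (auto simp: in_sccs_verts_conv_reachable)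
  then show False
    using assms(3) graph_symmetric[of u v] by auto
qed

lemma components_cover: "(\<Union>c\<in>components G. verts c) = verts G"
  using arg_cong[OF graph_is_union_sccs, of verts] by (simp add: components_eq_sccs Union_def)

lemma component_induced: "c \<in> components G \<Longrightarrow> induced_subgraph c G"
  unfolding components_eq_sccs by (rule in_sccs_imp_induced)

lemma component_nonempty: "c \<in> components G \<Longrightarrow> verts c \<noteq> {}"
  unfolding components_eq_sccs by (erule in_sccsE) (simp add: strongly_connected_def)

lemma components_disjoint:
  "c \<in> components G \<Longrightarrow> d \<in> components G \<Longrightarrow> c \<noteq> d \<Longrightarrow> verts c \<inter> verts d = {}"
  unfolding components_eq_sccs by (rule scc_disj)

lemma component_adjacency:
  assumes "c \<in> components G" "u \<in> verts c" "v \<in> verts c"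
  shows "adjacency c u v = adjacency G u v"
proof -
  have "u \<rightarrow>\<^bsub>c\<^esub> v \<longleftrightarrow> u \<rightarrow> v"
    using component_induced[OF assms(1)] assms(2,3)
    by (auto simp: induced_subgraph_def subgraph_def compatible_def arcs_ends_def arc_to_ends_def)
  then show ?thesis by (simp add: adjacency_def)
qed

end

text \<open>The components partition the vertices and no arc joins two of them, so the matrix is
  block diagonal.\<close>

lemma (in pseudo_graph) graph_char_poly_components:
  assumes "finite (components G)"
  shows "graph_char_poly G = (\<Prod>c\<in>components G. graph_char_poly c)"
proof -
  have fin: "finite (verts c)" if "c \<in> components G" for c
    using components_cover that by (intro finite_subset[OF _ finite_verts]) auto
  have "graph_char_poly G = set_char_poly (\<Union>c\<in>components G. verts c) (adjacency G)"
    by (simp add: graph_char_poly_altdef components_cover)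
  also have "\<dots> = (\<Prod>c\<in>components G. set_char_poly (verts c) (adjacency G))"
  proof (rule set_char_poly_UN[OF assms fin components_disjoint])
    fix c d u v
    assume "c \<in> components G" "d \<in> components G" "c \<noteq> d" "u \<in> verts c" "v \<in> verts d"
    then show "adjacency G u v = 0"
      using components_disjoint component_closed[of c u v] by (auto simp: adjacency_def)
  qed
  also have "\<dots> = (\<Prod>c\<in>components G. graph_char_poly c)"
    unfolding graph_char_poly_altdef
    by (intro prod.cong refl set_char_poly_cong fin component_adjacency[symmetric])
  finally show ?thesis .
qed


section \<open>Main eigenvalues of graphs\<close>

text \<open>Transports eigenvectors along the enumeration, in both directions, between vectors
  indexed by numbers and functions on vertices.\<close>

lemma main_eigenvalue_iff:
  assumes "finite (verts G)"
  shows "main_eigenvalue G \<theta> \<longleftrightarrow> main_value (verts G) (adjacency G) (\<lambda>_. 1) \<theta>"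
proof -
  define n where "n = card (verts G)"
  define e where "e = vertex_enum G"
  have e: "bij_betw e {0..<n} (verts G)"
    unfolding e_def n_def by (rule vertex_enum_bij[OF assms])
  have reindex: "(\<Sum>u\<in>verts G. g u) = (\<Sum>j = 0..<n. g (e j))" for g :: "_ \<Rightarrow> real"
    by (rule sum.reindex_bij_betw[OF e, symmetric])
  have enum: "\<exists>i<n. u = e i" if "u \<in> verts G" for u
    using that bij_betw_imp_surj_on[OF e] by force
  have A: "adj_matrix G = mat n n (\<lambda>(i,j). adjacency G (e i) (e j))"
    unfolding n_def e_def by (rule adj_matrix_altdef)
  have "main_value (verts G) (adjacency G) (\<lambda>_. 1) \<theta>" if "main_eigenvalue G \<theta>"
  proof -
    from that obtain v where v: "v \<in> carrier_vec n" "adj_matrix G *\<^sub>v v = \<theta> \<cdot>\<^sub>v v"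
      "v \<bullet> vec n (\<lambda>_. 1) \<noteq> 0"
      by (auto simp: main_eigenvalue_def eigenvector_def A n_def)
    define x where "x u = v $ inv_into {0..<n} e u" for u
    have x: "x (e i) = v $ i" if "i < n" for i
      using that by (simp add: x_def bij_betw_inv_into_left[OF e])
    have "matop (verts G) (adjacency G) x u = \<theta> * x u" if u: "u \<in> verts G" for u
    proof -
      obtain i where i: "i < n" "u = e i" using enum[OF u] by blast
      have "matop (verts G) (adjacency G) x u = (\<Sum>j = 0..<n. adjacency G (e i) (e j) * v $ j)"
        unfolding matop_def reindex i(2) by (intro sum.cong) (auto simp: x)
      also have "\<dots> = (adj_matrix G *\<^sub>v v) $ i"
        using i(1) v(1) by (simp add: A scalar_prod_def)
      also have "\<dots> = \<theta> * x u" using i v(1,2) by (simp add: x)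
      finally show ?thesis .
    qed
    moreover have "dotp (verts G) x (\<lambda>_. 1) = v \<bullet> vec n (\<lambda>_. 1)"
      unfolding dotp_def reindex using v(1) by (simp add: x scalar_prod_def)
    ultimately show ?thesis
      unfolding main_value_def using v(3) by metis
  qed
  moreover have "main_eigenvalue G \<theta>" if "main_value (verts G) (adjacency G) (\<lambda>_. 1) \<theta>"
  proof -
    from that obtain x where x: "\<And>u. u \<in> verts G \<Longrightarrow> matop (verts G) (adjacency G) x u = \<theta> * x u"
      "dotp (verts G) x (\<lambda>_. 1) \<noteq> 0"
      by (auto simp: main_value_def)
    define v where "v = vec n (\<lambda>i. x (e i))"
    have one: "v \<bullet> vec n (\<lambda>_. 1) = dotp (verts G) x (\<lambda>_. 1)"
      unfolding dotp_def reindex by (simp add: v_def scalar_prod_def)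
    have "adj_matrix G *\<^sub>v v = \<theta> \<cdot>\<^sub>v v"
    proof (rule eq_vecI)
      fix i assume "i < dim_vec (\<theta> \<cdot>\<^sub>v v)"
      then have i: "i < n" by (simp add: v_def)
      then have "(adj_matrix G *\<^sub>v v) $ i = matop (verts G) (adjacency G) x (e i)"
        unfolding matop_def reindex by (simp add: A v_def scalar_prod_def)
      also have "\<dots> = \<theta> * x (e i)"
        using i bij_betw_apply[OF e] by (intro x(1)) simp
      finally show "(adj_matrix G *\<^sub>v v) $ i = (\<theta> \<cdot>\<^sub>v v) $ i"
        using i by (simp add: v_def)
    qed (simp add: A v_def)
    moreover have "v \<noteq> 0\<^sub>v n" using one x(2) by auto
    ultimately have "eigenvector (adj_matrix G) v \<theta>"
      by (simp add: eigenvector_def A v_def)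
    then show ?thesis
      unfolding main_eigenvalue_def using one x(2) n_def by auto
  qed
  ultimately show ?thesis by blast
qed

lemma adjacency_of_rat: "of_rat (adjacency G u v) = (adjacency G u v :: 'a::field_char_0)"
  by (simp add: adjacency_def)

context pseudo_graph
begin

lemma adjacency_sym: "adjacency G u v = adjacency G v u"
  using graph_symmetric[of u v] graph_symmetric[of v u] by (auto simp: adjacency_def)

lemma finite_main_eigenvalues: "finite {\<theta>. main_eigenvalue G \<theta>}"
  unfolding main_eigenvalue_iff[OF finite_verts]
  by (rule finite_main_values[OF finite_verts]) (rule adjacency_sym)

text \<open>Recovers the main eigenvalues from the main polynomial, so graphs with equal main
  polynomials share them.\<close>

lemma poly_main_poly_eq_0_iff: "poly (main_poly G) \<theta> = 0 \<longleftrightarrow> main_eigenvalue G \<theta>"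
  using finite_main_eigenvalues by (auto simp: main_poly_def poly_prod)

lemma irreducible_dvd_main_poly:
  assumes "irreducible f" "poly (map_poly of_rat f) \<theta> = 0" "main_eigenvalue G \<theta>"
  shows "map_poly of_rat f dvd main_poly G"
proof -
  have "map_poly of_rat f dvd (\<Prod>\<theta> | main_value (verts G)
      (\<lambda>u v. of_rat (adjacency G u v)) (\<lambda>_. of_rat 1) \<theta>. [:- \<theta>, 1:] :: real poly)"
  proof (rule irreducible_dvd_main_polynomial[OF finite_verts _ assms(1,2)])
    show "adjacency G u v = adjacency G v u" for u v by (rule adjacency_sym)
    show "main_value (verts G) (\<lambda>u v. of_rat (adjacency G u v)) (\<lambda>_. of_rat 1) \<theta>"
      using assms(3) by (simp add: main_eigenvalue_iff adjacency_of_rat)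
  qed
  then show ?thesis
    by (simp add: main_poly_def main_eigenvalue_iff adjacency_of_rat)
qed

lemma component_finite: "c \<in> components G \<Longrightarrow> finite (verts c)"
  using components_cover by (intro finite_subset[OF _ finite_verts]) auto

lemma component_main_eigenvalue:
  assumes c: "c \<in> components G" and main: "main_eigenvalue c \<theta>"
  shows "main_eigenvalue G \<theta>"
proof -
  obtain x where x: "\<And>u. u \<in> verts c \<Longrightarrow> matop (verts c) (adjacency c) x u = \<theta> * x u"
    "dotp (verts c) x (\<lambda>_. 1) \<noteq> 0"
    using main unfolding main_eigenvalue_iff[OF component_finite[OF c]] main_value_def by blast
  define y where "y u = (if u \<in> verts c then x u else 0)" for u
  have sub: "verts c \<subseteq> verts G" using components_cover c by auto
  have matop_y: "matop (verts G) (adjacency G) y u = (\<Sum>w\<in>verts c. adjacency G u w * x w)" for u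
    unfolding matop_def using sub
    by (intro sum.mono_neutral_cong_right) (auto simp: y_def)
  have "matop (verts G) (adjacency G) y u = \<theta> * y u" for u
  proof (cases "u \<in> verts c")
    case True
    have "matop (verts G) (adjacency G) y u = matop (verts c) (adjacency c) x u"
      unfolding matop_y unfolding matop_def
      by (intro sum.cong refl) (simp add: component_adjacency[OF c True])
    then show ?thesis using x(1)[OF True] True by (simp add: y_def)
  next
    case False
    \<comment> \<open>An arc between \<open>u\<close> and a vertex of \<open>c\<close> would put
      \<open>u\<close> into \<open>c\<close>.\<close>
    have "adjacency G u w = (0::real)" if "w \<in> verts c" for w
      using component_closed[OF c that, of u] False graph_symmetric[of u w]
      by (auto simp: adjacency_def)
    then show ?thesis using False by (simp add: matop_y y_def)
  qed
  moreover have "dotp (verts G) y (\<lambda>_. 1) = dotp (verts c) x (\<lambda>_. 1)"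
    unfolding dotp_def using sub
    by (intro sum.mono_neutral_cong_right) (auto simp: y_def)
  ultimately show ?thesis
    using x(2) unfolding main_eigenvalue_iff[OF finite_verts] main_value_def by metis
qed

text \<open>A component has a vertex, so the all-one vector is nonzero on it and yields an
  eigenvector not orthogonal to it.\<close>

lemma component_has_main_eigenvalue:
  assumes c: "c \<in> components G"
  obtains \<theta> where "main_eigenvalue c \<theta>"
proof -
  obtain u where u: "u \<in> verts c" using component_nonempty[OF c] by blast
  have "adjacency c v w = (adjacency c w v :: real)" if "v \<in> verts c" "w \<in> verts c" for v w
    using component_adjacency[OF c] that adjacency_sym by metis
  then obtain \<theta> and v :: "_ \<Rightarrow> real"
    where "\<And>i. i \<in> verts c \<Longrightarrow> matop (verts c) (adjacency c) v i = \<theta> * v i"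
      "dotp (verts c) v (\<lambda>_. 1) \<noteq> 0"
    using exists_eigenvector_not_orthogonal[where V = "verts c" and a = "adjacency c"
        and x = "\<lambda>_. 1", OF component_finite[OF c] _ u] by (metis zero_neq_one)
  then have "main_eigenvalue c \<theta>"
    unfolding main_eigenvalue_iff[OF component_finite[OF c]] main_value_def by blast
  then show ?thesis by (rule that)
qed

end

section \<open>Multiplicities of irreducible factors and the final count\<close>

lemma multiplicity_prod_monic_irreducible:
  fixes f :: "'i \<Rightarrow> rat poly"
  assumes "finite I" "inj_on f I" "\<And>k. k \<in> I \<Longrightarrow> lead_coeff (f k) = 1 \<and> irreducible (f k)"
    and i: "i \<in> I"
  shows "multiplicity (f i) (\<Prod>k\<in>I. f k ^ m k) = m i"
proof -
  have irr: "irreducible (f k)" "f k \<noteq> 0" "lead_coeff (f k) = 1" if "k \<in> I" for k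
    using assms(3)[OF that] by auto
  have prime: "prime_elem (f i)" using irr(1)[OF i] by (rule irreducible_imp_prime_elem)
  have mult: "multiplicity (f i) (f k) = (if k = i then 1 else 0)" if k: "k \<in> I" for k
  proof (cases "k = i")
    case True
    then show ?thesis
      using irr(2)[OF i] irreducible_not_unit[OF irr(1)[OF i]] by (simp add: multiplicity_self)
  next
    case False
    \<comment> \<open>Irreducible polynomials dividing one another are associated, and monic
      associated ones are equal, against injectivity.\<close>
    have "\<not> f i dvd f k"
    proof
      assume dvd: "f i dvd f k"
      then have "f k dvd f i"
        using irreducibleD'[OF irr(1)[OF k]] irreducible_not_unit[OF irr(1)[OF i]] by blast
      then have "f i = f k"
        using dvd irr(3)[OF i] irr(3)[OF k] by (intro poly_dvd_antisym) auto
      then show False using assms(2) i k False by (auto dest: inj_onD)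
    qed
    then show ?thesis using False by (simp add: not_dvd_imp_multiplicity_0)
  qed
  have "multiplicity (f i) (\<Prod>k\<in>I. f k ^ m k) = (\<Sum>k\<in>I. multiplicity (f i) (f k ^ m k))"
    using irr(2) assms(1) by (intro prime_elem_multiplicity_prod_distrib[OF prime]) auto
  also have "\<dots> = (\<Sum>k\<in>I. if k = i then m k else 0)"
    by (intro sum.cong refl) (simp add: prime_elem_multiplicity_power_distrib[OF prime irr(2)] mult)
  also have "\<dots> = m i" using assms(1) i by simp
  finally show ?thesis .
qed

theorem theorem3p1:
  fixes G :: "('a,'b) pre_digraph" and H :: "('c,'d) pre_digraph"
    and r :: nat and f :: "nat \<Rightarrow> rat poly" and m :: "nat \<Rightarrow> nat"
    and C :: "nat \<Rightarrow> ('c,'d) pre_digraph"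
  assumes "graph G" and "graph H"
    and "graph_char_poly H = graph_char_poly G"
    and "main_poly H = main_poly G"
    and "graph_char_poly G = (\<Prod>i=1..r. f i ^ m i)"
    and "inj_on f {1..r}"
    and "\<forall>i\<in>{1..r}. lead_coeff (f i) = 1 \<and> irreducible (f i) \<and> m i \<ge> 1"
    and "bij_betw C {1..num_components H} (components H)"
  shows "(\<forall>i\<in>{1..r}. (\<Sum>j=1..num_components H. multiplicity (f i) (graph_char_poly (C j))) = m i)
    \<and> (\<forall>j\<in>{1..num_components H}.
         (\<Sum>i\<in>main_indices G r f. multiplicity (f i) (graph_char_poly (C j))) \<ge> 1)
    \<and> num_components H \<le> main_factor_multiplicity G r f m"
proof -
  interpret G: graph G by fact
  interpret H: graph H by fact
  interpret h: map_poly_comm_ring_hom "of_rat :: rat \<Rightarrow> real" ..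
  define K where "K = {1..num_components H}"
  define \<chi> where "\<chi> j = graph_char_poly (C j)" for j
  note bij = assms(8)[folded K_def]
  have irr: "irreducible (f i)" "f i \<noteq> 0" if "i \<in> {1..r}" for i
    using assms(7) that by auto
  have "finite (components H)"
    using bij_betw_finite[OF bij] by (simp add: K_def)
  then have "graph_char_poly H = (\<Prod>c\<in>components H. graph_char_poly c)"
    by (rule H.graph_char_poly_components)
  then have prod: "(\<Prod>j\<in>K. \<chi> j) = (\<Prod>i=1..r. f i ^ m i)"
    using prod.reindex_bij_betw[OF bij, of graph_char_poly] assms(3,5) by (simp add: \<chi>_def)
  \<comment> \<open>Additivity of multiplicities over the product requires nonzero factors.\<close>
  also have "\<dots> \<noteq> 0" using irr(2) by simp
  finally have \<chi>0: "\<chi> j \<noteq> 0" if "j \<in> K" for j using that by (auto simp: K_def)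
  have sums: "(\<Sum>j\<in>K. multiplicity (f i) (\<chi> j)) = m i" if i: "i \<in> {1..r}" for i
  proof -
    have "(\<Sum>j\<in>K. multiplicity (f i) (\<chi> j)) = multiplicity (f i) (\<Prod>j\<in>K. \<chi> j)"
      using \<chi>0 irr(1)[OF i]
      by (intro prime_elem_multiplicity_prod_distrib[symmetric] irreducible_imp_prime_elem)
        (auto simp: K_def)
    also have "\<dots> = m i"
      unfolding prod using assms(6,7) i by (intro multiplicity_prod_monic_irreducible) auto
    finally show ?thesis .
  qed
  have comps: "(\<Sum>i\<in>main_indices G r f. multiplicity (f i) (\<chi> j)) \<ge> 1" if j: "j \<in> K" for j
  proof -
    have c: "C j \<in> components H" using bij_betw_apply[OF bij j] .
    obtain \<theta> where \<theta>: "main_eigenvalue (C j) \<theta>"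
      using H.component_has_main_eigenvalue[OF c] .
    have "main_eigenvalue H \<theta>" using c \<theta> by (rule H.component_main_eigenvalue)
    then have main: "main_eigenvalue G \<theta>"
      using H.poly_main_poly_eq_0_iff G.poly_main_poly_eq_0_iff assms(4) by simp
    then have "poly (map_poly of_rat (\<Prod>i=1..r. f i ^ m i)) \<theta> = 0"
      using main_eigenvalue_root[OF main] assms(5) by simp
    \<comment> \<open>One index serves both sides: \<open>f i\<close> shares the root \<theta> with
      the characteristic polynomial of the component, and \<theta> is a main eigenvalue of
      \<open>G\<close>.\<close>
    then obtain i where i: "i \<in> {1..r}" "poly (map_poly of_rat (f i)) \<theta> = 0"
      by (auto simp: h.hom_prod h.hom_power poly_prod)
    have "f i dvd \<chi> j"
      unfolding \<chi>_def using irr(1)[OF i(1)] i(2) main_eigenvalue_root[OF \<theta>]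
      by (rule irreducible_root_dvd)
    then have "1 \<le> multiplicity (f i) (\<chi> j)"
      using multiplicity_gt_zero_iff[OF \<chi>0[OF j], of "f i"] irreducible_not_unit[OF irr(1)[OF i(1)]]
      by simp
    also have "i \<in> main_indices G r f"
      using i G.irreducible_dvd_main_poly[OF irr(1)[OF i(1)] i(2) main]
      by (simp add: main_indices_def)
    then have "multiplicity (f i) (\<chi> j) \<le> (\<Sum>i\<in>main_indices G r f. multiplicity (f i) (\<chi> j))"
      by (rule member_le_sum) (auto simp: main_indices_def)
    finally show ?thesis .
  qed
  \<comment> \<open>Double counting: each component contributes at least 1 and each main factor
    \<open>f i\<close> contributes exactly \<open>m i\<close>.\<close>
  have "num_components H = (\<Sum>j\<in>K. 1)" by (simp add: K_def)
  also have "\<dots> \<le> (\<Sum>j\<in>K. \<Sum>i\<in>main_indices G r f. multiplicity (f i) (\<chi> j))"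
    using comps by (rule sum_mono)
  also have "\<dots> = (\<Sum>i\<in>main_indices G r f. \<Sum>j\<in>K. multiplicity (f i) (\<chi> j))"
    by (rule sum.swap)
  also have "\<dots> = main_factor_multiplicity G r f m"
    unfolding main_factor_multiplicity_def
    by (intro sum.cong refl sums) (auto simp: main_indices_def)
  finally show ?thesis using sums comps by (auto simp: K_def \<chi>_def)
qed

end
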